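(* There exists a countable non-abelian simple group $M$ such that all finite subgroups of $M$ are cyclic and, for every prime $p$, the group $M$ has an element of order $p$. *)

theory Defs
  imports "HOL-Algebra.Algebra" "HOL-Library.Countable_Set"
begin

text \<open>
  The library locale \<open>simple_group\<close> asks for \<open>order G > 1\<close>. As \<open>order\<close> is the cardinality
  as a natural number, with value 0 on infinite carriers, that locale contains no infinite
  group. The following definition differs only in expressing non-triviality without \<open>order\<close>,
  so that it is also correct for infinite groups.
\<close>

definition is_simple :: "('a, 'b) monoid_scheme \<Rightarrow> bool" where
  "is_simple G \<longleftrightarrow>
     group G \<and> carrier G \<noteq> {\<one>\<^bsub>G\<^esub>} \<and>
     (\<forall>H. H \<lhd> G \<longrightarrow> H = carrier G \<or> H = {\<one>\<^bsub>G\<^esub>})"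

lemma simple_group_iff_finite_is_simple:
  "simple_group G \<longleftrightarrow> is_simple G \<and> finite (carrier G)"
proof
  assume "simple_group G"
  then interpret simple_group G .
  have "finite (carrier G)"
    using order_gt_one by (metis card.infinite not_less_zero order_def)
  then show "is_simple G \<and> finite (carrier G)"
    using simple_not_triv no_real_normal_subgroup is_group by (simp add: is_simple_def)
next
  assume *: "is_simple G \<and> finite (carrier G)"
  then interpret group G by (simp add: is_simple_def)
  have "order G > 0"
    using * order_gt_0_iff_finite by blast
  moreover have "order G \<noteq> 1"
    using * unfolding is_simple_def order_def by (metis card_1_singletonE one_closed singletonD)
  ultimately have "order G > 1" by linarith
  then show "simple_group G"
    using * by unfold_locales (auto simp: is_simple_def)
qed

end

theory Submission
  imports Defs
begin

text \<open>
  The witness is \<open>PSL\<^sub>2(K) = SL\<^sub>2(K)/{1,-1}\<close> for a countable subfield \<open>K\<close> of the reals that contains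
  \<open>cos (\<pi>/n)\<close> and \<open>sin (\<pi>/n)\<close> for all \<open>n\<close>.

  Simplicity is the classical theorem on \<open>PSL\<^sub>2\<close> over a field: a normal subgroup of \<open>SL\<^sub>2(K)\<close> with
  an element other than \<open>1\<close> and \<open>-1\<close> contains, after taking commutators, all unipotent
  triangular matrices, and these generate \<open>SL\<^sub>2(K)\<close> (\<open>normal_subgroup_SL2\<close>). The rotation by
  \<open>\<pi>/p\<close> has \<open>p\<close>-th power \<open>-1\<close>, so its image in the quotient has order \<open>p\<close>.

  Finite subgroups are cyclic because \<open>K\<close> is real. A finite subgroup \<open>F\<close> of \<open>SL\<^sub>2(\<real>)\<close> preserves a
  positive definite quadratic form, obtained by averaging, and hence a point \<open>z\<close> of the upper half
  plane, namely a root of that form. The automorphy factor \<open>(a, b, c, d) \<mapsto> c z + d\<close>, that is, the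
  eigenvalue of the matrix on the line spanned by \<open>(z, 1)\<close>, is then an injective homomorphism from
  \<open>F\<close> to the nonzero complex numbers, whose finite subgroups consist of roots of unity and are
  cyclic (\<open>finite_subgroup_SL2_real_cyclic\<close>). A finite subgroup of the quotient has a finite preimage
  in \<open>SL\<^sub>2(K)\<close>, so it is cyclic as the image of a cyclic group
  (\<open>finite_subgroup_image_cyclic\<close>). That \<open>K\<close> is real is essential: over the complex numbers,
  \<open>PSL\<^sub>2\<close> contains the alternating group on four letters.
\<close>

section \<open>Groups and homomorphisms\<close>

text \<open>
  By Lagrange's theorem the image consists of \<open>n\<close>-th roots of unity, where \<open>n\<close> is the order of the
  group. There are only \<open>n\<close> of these, so injectivity makes the image the whole cyclic group of roots
  of unity, and any preimage of \<open>cis (2\<pi>/n)\<close> is a generator.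
\<close>

lemma (in group) cyclic_if_faithful_complex_character:
  fixes \<chi> :: "'a \<Rightarrow> complex"
  assumes fin: "finite (carrier G)"
    and hom: "\<And>x y. \<lbrakk>x \<in> carrier G; y \<in> carrier G\<rbrakk> \<Longrightarrow> \<chi> (x \<otimes> y) = \<chi> x * \<chi> y"
    and one: "\<chi> \<one> = 1"
    and inj: "inj_on \<chi> (carrier G)"
  shows "cyclic_group G"
proof -
  define n where "n = card (carrier G)"
  have n: "n > 0"
    using fin one_closed unfolding n_def by (metis card_gt_0_iff empty_iff)
  let ?\<omega> = "\<lambda>k. cis (2 * pi * real k / real n)"
  have roots: "bij_betw ?\<omega> {..<n} {z. z ^ n = 1}"
    by (rule bij_betw_roots_unity[OF n])
  have pow: "\<chi> (x [^] k) = \<chi> x ^ k" if "x \<in> carrier G" for x and k :: nat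
    using that by (induction k) (simp_all add: one hom)
  have "\<chi> ` carrier G = {z. z ^ n = 1}"
  proof (rule card_subset_eq)
    show "finite {z::complex. z ^ n = 1}"
      using bij_betw_finite[OF roots] by simp
    show "\<chi> ` carrier G \<subseteq> {z. z ^ n = 1}"
    proof safe
      fix x assume x: "x \<in> carrier G"
      then have "x [^] n = \<one>"
        using pow_order_eq_1[OF x] by (simp add: order_def n_def)
      then show "\<chi> x ^ n = 1"
        using pow[OF x, of n] one by simp
    qed
    show "card (\<chi> ` carrier G) = card {z::complex. z ^ n = 1}"
      using bij_betw_same_card[OF roots] by (simp add: card_image[OF inj] n_def)
  qed
  note image = this
  have "?\<omega> 1 ^ n = 1"
    using n by (simp add: DeMoivre)
  then obtain x where x: "x \<in> carrier G" "\<chi> x = ?\<omega> 1"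
    using image by (metis (mono_tags, lifting) imageE mem_Collect_eq)
  have "y \<in> range (\<lambda>k::int. x [^] k)" if y: "y \<in> carrier G" for y
  proof -
    have "\<chi> y \<in> {z. z ^ n = 1}" using image y by blast
    then obtain k where "\<chi> y = ?\<omega> k"
      using roots by (auto simp: bij_betw_def)
    also have "\<dots> = \<chi> (x [^] k)"
      by (simp add: pow x DeMoivre field_simps)
    finally have "y = x [^] k"
      using inj y x by (simp add: inj_on_eq_iff)
    then have "y = x [^] int k"
      by (simp add: int_pow_int)
    then show ?thesis by blast
  qed
  then have "carrier G = range (\<lambda>k::int. x [^] k)"
    using x by auto
  then show ?thesis
    using x cyclic_group by blast
qed

text \<open>
  Numbering the cosets of \<open>H\<close> gives a copy of the quotient group with natural numbers as elements,
  namely \<open>image_group f G\<close>.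
\<close>

lemma (in group) ex_image_group_nat:
  assumes "countable (carrier G)" "H \<lhd> G"
  obtains f :: "'a \<Rightarrow> nat" where "weak_group_morphism f H G"
proof -
  interpret H: normal H G by fact
  have count: "countable ((\<lambda>a. H #> a) ` carrier G)"
    using assms(1) by blast
  let ?f = "\<lambda>a. to_nat_on ((\<lambda>a. H #> a) ` carrier G) (H #> a)"
  have "weak_group_morphism ?f H G"
  proof (rule weak_group_morphismsI[OF assms(2)])
    fix a b assume ab: "a \<in> carrier G" "b \<in> carrier G"
    have "?f a = ?f b \<longleftrightarrow> H #> a = H #> b"
      using inj_on_to_nat_on[OF count] ab by (simp add: inj_on_eq_iff)
    also have "\<dots> \<longleftrightarrow> a \<otimes> inv b \<in> H"
      using ab H.rcos_module[OF is_group] rcos_self[OF _ H.subgroup_axioms]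
        repr_independence[OF _ _ H.subgroup_axioms] by metis
    finally show "?f a = ?f b \<longleftrightarrow> a \<otimes> inv b \<in> H" .
  qed
  then show thesis by (rule that)
qed

lemma (in group_hom) subgroup_preimage:
  assumes "subgroup N H"
  shows "subgroup {g \<in> carrier G. h g \<in> N} G"
proof -
  interpret N: subgroup N H by fact
  show ?thesis
    by (rule G.subgroupI) (auto intro: G.one_closed)
qed

lemma (in group_hom) normal_preimage:
  assumes "N \<lhd> H"
  shows "{g \<in> carrier G. h g \<in> N} \<lhd> G"
proof -
  interpret N: normal N H by fact
  show ?thesis
    by (auto simp: G.normal_inv_iff subgroup_preimage[OF N.subgroup_axioms] N.inv_op_closed2)
qed

lemma (in group_hom) is_simple_image:
  assumes surj: "h ` carrier G = carrier H"
    and nontriv: "kernel G H h \<noteq> carrier G"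
    and normal: "\<And>N. N \<lhd> G \<Longrightarrow> N \<subseteq> kernel G H h \<or> N = carrier G"
  shows "is_simple H"
  unfolding is_simple_def
proof (intro conjI allI impI)
  show "group H" by simp
  show "carrier H \<noteq> {\<one>\<^bsub>H\<^esub>}"
    using surj nontriv by (auto simp: kernel_def)
  fix N assume N: "N \<lhd> H"
  interpret N: normal N H by fact
  have "N \<subseteq> h ` carrier G"
    using surj N.subset by simp
  moreover define P where "P = {g \<in> carrier G. h g \<in> N}"
  ultimately have image: "h ` P = N"
    by blast
  have "P \<lhd> G"
    unfolding P_def by (rule normal_preimage[OF N])
  then have "P \<subseteq> kernel G H h \<or> P = carrier G"
    by (rule normal)
  then show "N = carrier H \<or> N = {\<one>\<^bsub>H\<^esub>}"
  proof
    assume "P \<subseteq> kernel G H h"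
    then have "N \<subseteq> {\<one>\<^bsub>H\<^esub>}"
      unfolding image[symmetric] kernel_def by blast
    then show ?thesis using N.one_closed by blast
  next
    assume "P = carrier G"
    then show ?thesis using image surj by simp
  qed
qed

text \<open>
  The fibres of \<open>h\<close> are cosets of the finite kernel, so the preimage of a finite subgroup is a finite
  subgroup of \<open>G\<close>. It is cyclic and maps onto the given subgroup.
\<close>

lemma (in group_hom) finite_subgroup_image_cyclic:
  assumes surj: "h ` carrier G = carrier H"
    and ker: "finite (kernel G H h)"
    and cyclic: "\<And>F. \<lbrakk>subgroup F G; finite F\<rbrakk> \<Longrightarrow> cyclic_group (G\<lparr>carrier := F\<rparr>)"
    and F: "subgroup F H" "finite F"
  shows "cyclic_group (H\<lparr>carrier := F\<rparr>)"
proof -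
  interpret F: subgroup F H by fact
  let ?P = "{g \<in> carrier G. h g \<in> F}"
  have P: "subgroup ?P G" by (rule subgroup_preimage[OF F(1)])
  have finP: "finite ?P"
  proof (rule ccontr)
    assume "infinite ?P"
    moreover have "finite (h ` ?P)"
      by (rule finite_subset[OF _ F(2)]) auto
    ultimately obtain a where a: "a \<in> ?P" "infinite {g \<in> ?P. h g = h a}"
      using pigeonhole_infinite by blast
    have "{g \<in> ?P. h g = h a} \<subseteq> (\<lambda>k. k \<otimes> a) ` kernel G H h"
    proof
      fix g assume "g \<in> {g \<in> ?P. h g = h a}"
      then have "g = (g \<otimes> inv a) \<otimes> a" "g \<otimes> inv a \<in> kernel G H h"
        using a by (auto simp: kernel_def G.m_assoc)
      then show "g \<in> (\<lambda>k. k \<otimes> a) ` kernel G H h" by blast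
    qed
    then show False
      using a ker finite_subset by blast
  qed
  have "F \<subseteq> h ` carrier G"
    using surj F.subset by simp
  then have "h ` ?P = F"
    by blast
  then have "h \<in> epi (G\<lparr>carrier := ?P\<rparr>) (H\<lparr>carrier := F\<rparr>)"
    by (auto simp: epi_def hom_def)
  then show ?thesis
    using group.cyclic_group_epimorphic_image cyclic[OF P finP]
      subgroup.subgroup_is_group[OF P G.group_axioms] F.subgroup_is_group[OF H.group_axioms]
    by blast
qed

section \<open>The special linear group of degree two\<close>

text \<open>
  The quadruple \<open>(a, b, c, d)\<close> stands for the matrix with rows \<open>(a, b)\<close> and \<open>(c, d)\<close>. The set \<open>K\<close> of
  admissible entries is a parameter, so that a subfield need not be a type of its own.
\<close>

definition SL2 :: "'a::field set \<Rightarrow> ('a \<times> 'a \<times> 'a \<times> 'a) monoid" where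
  "SL2 K = \<lparr>carrier = {(a, b, c, d). a \<in> K \<and> b \<in> K \<and> c \<in> K \<and> d \<in> K \<and> a * d - b * c = 1},
     monoid.mult = (\<lambda>(a, b, c, d) (a', b', c', d').
       (a * a' + b * c', a * b' + b * d', c * a' + d * c', c * b' + d * d')),
     monoid.one = (1, 0, 0, 1)\<rparr>"

lemma SL2_carrier [simp]:
  "(a, b, c, d) \<in> carrier (SL2 K) \<longleftrightarrow>
    a \<in> K \<and> b \<in> K \<and> c \<in> K \<and> d \<in> K \<and> a * d - b * c = 1"
  by (simp add: SL2_def)

lemma SL2_mult [simp]:
  "(a, b, c, d) \<otimes>\<^bsub>SL2 K\<^esub> (a', b', c', d') =
    (a * a' + b * c', a * b' + b * d', c * a' + d * c', c * b' + d * d')"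
  by (simp add: SL2_def)

lemma SL2_one [simp]: "\<one>\<^bsub>SL2 K\<^esub> = (1, 0, 0, 1)"
  by (simp add: SL2_def)

abbreviation plus_minus_one :: "('a::field \<times> 'a \<times> 'a \<times> 'a) set" where
  "plus_minus_one \<equiv> {(1, 0, 0, 1), (-1, 0, 0, -1)}"

locale subfield_char_0 =
  fixes K :: "'a::field_char_0 set"
  assumes one_mem [simp]: "1 \<in> K"
    and diff_mem [simp]: "\<lbrakk>x \<in> K; y \<in> K\<rbrakk> \<Longrightarrow> x - y \<in> K"
    and mult_mem [simp]: "\<lbrakk>x \<in> K; y \<in> K\<rbrakk> \<Longrightarrow> x * y \<in> K"
    and inverse_mem [simp]: "x \<in> K \<Longrightarrow> inverse x \<in> K"
begin

lemma zero_mem [simp]: "0 \<in> K"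
  using diff_mem[of 1 1] by simp

lemma uminus_mem [simp]: "x \<in> K \<Longrightarrow> - x \<in> K"
  using diff_mem[of 0 x] by simp

lemma add_mem [simp]: "\<lbrakk>x \<in> K; y \<in> K\<rbrakk> \<Longrightarrow> x + y \<in> K"
  using diff_mem[of x "- y"] by simp

lemma divide_mem [simp]: "\<lbrakk>x \<in> K; y \<in> K\<rbrakk> \<Longrightarrow> x / y \<in> K"
  by (simp add: divide_inverse)

lemma numeral_mem [simp]: "numeral n \<in> K"
  by (induction n) (simp_all only: numeral.simps one_mem add_mem)

lemma group_SL2: "group (SL2 K)"
proof (rule groupI)
  fix x y assume "x \<in> carrier (SL2 K)" "y \<in> carrier (SL2 K)"
  moreover have "(a * a' + b * c') * (c * b' + d * d') - (a * b' + b * d') * (c * a' + d * c')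
      = (a * d - b * c) * (a' * d' - b' * c')" for a b c d a' b' c' d' :: 'a
    by (simp add: algebra_simps)
  ultimately show "x \<otimes>\<^bsub>SL2 K\<^esub> y \<in> carrier (SL2 K)"
    by (cases x; cases y) simp
next
  fix x y z
  show "x \<otimes>\<^bsub>SL2 K\<^esub> y \<otimes>\<^bsub>SL2 K\<^esub> z = x \<otimes>\<^bsub>SL2 K\<^esub> (y \<otimes>\<^bsub>SL2 K\<^esub> z)"
    by (cases x; cases y; cases z) (simp add: algebra_simps)
next
  fix x assume x: "x \<in> carrier (SL2 K)"
  obtain a b c d where [simp]: "x = (a, b, c, d)" by (cases x)
  show "\<one>\<^bsub>SL2 K\<^esub> \<otimes>\<^bsub>SL2 K\<^esub> x = x" by simp
  have "(d, - b, - c, a) \<in> carrier (SL2 K)"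
    using x by (simp add: mult.commute)
  moreover have "(d, - b, - c, a) \<otimes>\<^bsub>SL2 K\<^esub> x = \<one>\<^bsub>SL2 K\<^esub>"
    using x by (simp add: algebra_simps)
  ultimately show "\<exists>y\<in>carrier (SL2 K). y \<otimes>\<^bsub>SL2 K\<^esub> x = \<one>\<^bsub>SL2 K\<^esub>" by blast
qed simp

sublocale SL2: group "SL2 K"
  by (rule group_SL2)

lemma SL2_inv:
  assumes "(a, b, c, d) \<in> carrier (SL2 K)"
  shows "inv\<^bsub>SL2 K\<^esub> (a, b, c, d) = (d, - b, - c, a)"
  using assms by (intro SL2.inv_equality) (simp_all add: algebra_simps)

lemma centre_normal: "plus_minus_one \<lhd> SL2 K"
  unfolding SL2.normal_inv_iff
proof (intro conjI ballI)
  show "subgroup plus_minus_one (SL2 K)"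
    by (rule SL2.subgroupI) (auto simp: SL2_inv)
  fix x h assume x: "x \<in> carrier (SL2 K)" and h: "h \<in> (plus_minus_one :: ('a \<times> 'a \<times> 'a \<times> 'a) set)"
  obtain a b c d where x_eq: "x = (a, b, c, d)" by (cases x)
  show "x \<otimes>\<^bsub>SL2 K\<^esub> h \<otimes>\<^bsub>SL2 K\<^esub> inv\<^bsub>SL2 K\<^esub> x \<in> plus_minus_one"
    using h x unfolding x_eq by (auto simp: SL2_inv algebra_simps)
qed

text \<open>
  If \<open>c \<noteq> 0\<close>, then row and column reduction with the pivot \<open>c\<close> writes the matrix as a product upper,
  lower, upper of unipotent matrices. A matrix with \<open>c = 0\<close> has \<open>a \<noteq> 0\<close>, and adding its first row to
  the second one leads back to the first case.
\<close>

lemma mem_if_unipotents: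
  assumes H: "subgroup H (SL2 K)"
    and lower: "\<And>x. x \<in> K \<Longrightarrow> (1, 0, x, 1) \<in> H"
    and upper: "\<And>x. x \<in> K \<Longrightarrow> (1, x, 0, 1) \<in> H"
    and g: "g \<in> carrier (SL2 K)"
  shows "g \<in> H"
proof -
  interpret H: subgroup H "SL2 K" by fact
  have main: "(a, b, c, d) \<in> H" if "(a, b, c, d) \<in> carrier (SL2 K)" "c \<noteq> 0" for a b c d
  proof -
    have "(1, (a - 1) / c, 0, 1) \<otimes>\<^bsub>SL2 K\<^esub> (1, 0, c, 1) \<otimes>\<^bsub>SL2 K\<^esub> (1, (d - 1) / c, 0, 1) \<in> H"
      using that by (intro H.m_closed lower upper) simp_all
    moreover have "(1, (a - 1) / c, 0, 1) \<otimes>\<^bsub>SL2 K\<^esub> (1, 0, c, 1) \<otimes>\<^bsub>SL2 K\<^esub> (1, (d - 1) / c, 0, 1)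
        = (a, (a * d - 1) / c, c, d)"
      using that by (simp add: field_simps)
    moreover have "(a * d - 1) / c = b"
      using that by (simp add: field_simps)
    ultimately show ?thesis by metis
  qed
  obtain a b c d where g_eq: "g = (a, b, c, d)" by (cases g)
  show ?thesis
  proof (cases "c = 0")
    case False
    then show ?thesis using main g g_eq by simp
  next
    case True
    then have "a \<noteq> 0" using g g_eq by auto
    then have "(a, b, a, b + d) \<in> H"
      using g g_eq True by (intro main) (simp_all add: algebra_simps)
    then have "(1, 0, -1, 1) \<otimes>\<^bsub>SL2 K\<^esub> (a, b, a, b + d) \<in> H"
      by (intro H.m_closed lower) simp_all
    then show ?thesis using True g_eq by simp
  qed
qed

text \<open>
  Let \<open>u\<close> be the first unit vector. As \<open>c \<noteq> 0\<close>, the vectors \<open>u\<close> and \<open>g u\<close> are independent, and a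
  conjugation by an upper unipotent matrix makes \<open>g u\<close> a multiple of the second unit vector. The
  commutator of \<open>g\<close> with a diagonal matrix then maps the second axis along
  \<open>g u \<mapsto> u \<mapsto> u \<mapsto> g u \<mapsto> g u\<close> to itself (up to scalars), so it is lower triangular.
  Its diagonal entries are distinct, and therefore its commutators with lower unipotent matrices
  already give all lower unipotent matrices.
\<close>

lemma normal_subgroup_eq_SL2_if_lower_left_nonzero:
  assumes N: "N \<lhd> SL2 K" and g: "(a, b, c, d) \<in> N" and c: "c \<noteq> 0"
  shows "N = carrier (SL2 K)"
proof -
  interpret N: normal N "SL2 K" by fact
  note conj = N.inv_op_closed2
  have gK: "a \<in> K" "b \<in> K" "c \<in> K" "d \<in> K" "a * d - b * c = 1"
    using N.subset g by auto
  define t where "t = a + d"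
  have t: "t \<in> K" using gK by (simp add: t_def)
  have "(1, - a / c, 0, 1) \<otimes>\<^bsub>SL2 K\<^esub> (a, b, c, d) \<otimes>\<^bsub>SL2 K\<^esub> inv\<^bsub>SL2 K\<^esub> (1, - a / c, 0, 1) \<in> N"
    using gK by (intro conj g) simp_all
  also have "(1, - a / c, 0, 1) \<otimes>\<^bsub>SL2 K\<^esub> (a, b, c, d) \<otimes>\<^bsub>SL2 K\<^esub> inv\<^bsub>SL2 K\<^esub> (1, - a / c, 0, 1)
      = (0, - 1 / c, c, t)"
    using gK c by (simp add: SL2_inv t_def field_simps)
  finally have k: "(0, - 1 / c, c, t) \<in> N" .
  \<comment> \<open>The lower left entry of the commutator with the diagonal matrix of entries \<open>2\<close> and \<open>1/2\<close>.\<close>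
  define e where "e = - 3 * c * t / 4"
  have e: "e \<in> K" using gK t by (simp add: e_def)
  have "(2, 0, 0, 1 / 2) \<otimes>\<^bsub>SL2 K\<^esub> (0, - 1 / c, c, t) \<otimes>\<^bsub>SL2 K\<^esub> inv\<^bsub>SL2 K\<^esub> (2, 0, 0, 1 / 2)
      \<otimes>\<^bsub>SL2 K\<^esub> inv\<^bsub>SL2 K\<^esub> (0, - 1 / c, c, t) \<in> N"
    by (intro N.m_closed N.m_inv_closed conj k) simp
  also have "(2, 0, 0, 1 / 2) \<otimes>\<^bsub>SL2 K\<^esub> (0, - 1 / c, c, t) \<otimes>\<^bsub>SL2 K\<^esub> inv\<^bsub>SL2 K\<^esub> (2, 0, 0, 1 / 2)
      \<otimes>\<^bsub>SL2 K\<^esub> inv\<^bsub>SL2 K\<^esub> (0, - 1 / c, c, t) = (4, 0, e, 1 / 4)"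
    using gK c t by (simp add: SL2_inv e_def field_simps)
  finally have m: "(4, 0, e, 1 / 4) \<in> N" .
  have lower: "(1, 0, x, 1) \<in> N" if x: "x \<in> K" for x
  proof -
    \<comment> \<open>Conjugation by the triangular matrix with diagonal \<open>4, 1/4\<close> divides the parameter of a
      lower unipotent matrix by \<open>16\<close>, so that the commutator multiplies it by \<open>1 - 1/16 = 15/16\<close>.\<close>
    let ?l = "(1, 0, 16 * x / 15, 1)"
    have "?l \<otimes>\<^bsub>SL2 K\<^esub> (4, 0, e, 1 / 4) \<otimes>\<^bsub>SL2 K\<^esub> inv\<^bsub>SL2 K\<^esub> ?l
        \<otimes>\<^bsub>SL2 K\<^esub> inv\<^bsub>SL2 K\<^esub> (4, 0, e, 1 / 4) \<in> N"
      using x by (intro N.m_closed N.m_inv_closed conj m) simp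
    also have "?l \<otimes>\<^bsub>SL2 K\<^esub> (4, 0, e, 1 / 4) \<otimes>\<^bsub>SL2 K\<^esub> inv\<^bsub>SL2 K\<^esub> ?l
        \<otimes>\<^bsub>SL2 K\<^esub> inv\<^bsub>SL2 K\<^esub> (4, 0, e, 1 / 4) = (1, 0, x, 1)"
      using x e by (simp add: SL2_inv field_simps)
    finally show ?thesis .
  qed
  have upper: "(1, x, 0, 1) \<in> N" if x: "x \<in> K" for x
  proof -
    have "(0, -1, 1, 0) \<otimes>\<^bsub>SL2 K\<^esub> (1, 0, - x, 1) \<otimes>\<^bsub>SL2 K\<^esub> inv\<^bsub>SL2 K\<^esub> (0, -1, 1, 0) \<in> N"
      using x by (intro conj lower) simp_all
    then show ?thesis by (simp add: SL2_inv)
  qed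
  show ?thesis
    using mem_if_unipotents[OF N.subgroup_axioms lower upper] N.subset by blast
qed

text \<open>
  Unless \<open>N\<close> is the whole group, every element of \<open>N\<close> has lower left entry zero, by the previous
  lemma, and so have its conjugates. Conjugation by the quarter turn moves the upper right entry to that place, and conjugation by a lower unipotent matrix
  moves the difference of the diagonal entries there. So all elements of \<open>N\<close> are scalar, with
  square \<open>1\<close>.
\<close>

lemma normal_subgroup_SL2:
  assumes N: "N \<lhd> SL2 K"
  shows "N \<subseteq> plus_minus_one \<or> N = carrier (SL2 K)"
proof (rule disjCI)
  assume "N \<noteq> carrier (SL2 K)"
  interpret N: normal N "SL2 K" by fact
  note conj = N.inv_op_closed2
  have no_c: "c = 0" if "(a, b, c, d) \<in> N" for a b c d
    using normal_subgroup_eq_SL2_if_lower_left_nonzero[OF N that] \<open>N \<noteq> carrier (SL2 K)\<close> by blast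
  show "N \<subseteq> plus_minus_one"
  proof
    fix g assume "g \<in> N"
    moreover obtain a b c d where g_eq: "g = (a, b, c, d)" by (cases g)
    ultimately have g: "(a, b, c, d) \<in> N" by simp
    have det: "a * d - b * c = 1" using N.subset g by auto
    have c: "c = 0" by (rule no_c[OF g])
    have "(0, -1, 1, 0) \<otimes>\<^bsub>SL2 K\<^esub> (a, b, c, d) \<otimes>\<^bsub>SL2 K\<^esub> inv\<^bsub>SL2 K\<^esub> (0, -1, 1, 0) \<in> N"
      by (intro conj g) simp
    then have "(d, - c, - b, a) \<in> N" by (simp add: SL2_inv)
    then have b: "b = 0" using no_c by force
    have "(1, 0, 1, 1) \<otimes>\<^bsub>SL2 K\<^esub> (a, b, c, d) \<otimes>\<^bsub>SL2 K\<^esub> inv\<^bsub>SL2 K\<^esub> (1, 0, 1, 1) \<in> N"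
      by (intro conj g) simp
    then have "(a, 0, a - d, d) \<in> N" by (simp add: SL2_inv b c)
    then have "a = d" using no_c by force
    then have "a * a = 1" using det b by simp
    then have "a = 1 \<or> a = -1" by (simp add: square_eq_1_iff)
    then show "g \<in> plus_minus_one"
      using g_eq b c \<open>a = d\<close> by auto
  qed
qed

end

section \<open>Finite subgroups over the reals\<close>

text \<open>
  The form \<open>A x\<^sup>2 + 2 B x y + C y\<^sup>2\<close> is the sum over all \<open>g\<close> in \<open>F\<close> of the squared Euclidean norms of
  \<open>g (x, y)\<close>, that is, of the forms with matrix \<open>g\<^sup>T g\<close>. It is positive definite because every
  \<open>g\<close> is invertible, and invariant because right multiplication by an element of \<open>F\<close> permutes the
  summands. The two stated equations express the invariance of the coefficients \<open>A\<close> and \<open>B\<close>.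
\<close>

lemma invariant_quadratic_form:
  fixes K :: "real set"
  assumes "subfield_char_0 K" and F: "subgroup F (SL2 K)" "finite F"
  obtains A B C :: real where "A > 0" "A * C - B\<^sup>2 > 0"
    "\<And>a b c d. (a, b, c, d) \<in> F \<Longrightarrow>
      A * a\<^sup>2 + 2 * B * a * c + C * c\<^sup>2 = A \<and> A * a * b + B * (a * d + b * c) + C * c * d = B"
proof -
  interpret subfield_char_0 K by fact
  interpret F: subgroup F "SL2 K" by fact
  define qA qB qC :: "real \<times> real \<times> real \<times> real \<Rightarrow> real"
    where "qA = (\<lambda>(a, b, c, d). a\<^sup>2 + c\<^sup>2)" and "qB = (\<lambda>(a, b, c, d). a * b + c * d)"
      and "qC = (\<lambda>(a, b, c, d). b\<^sup>2 + d\<^sup>2)"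
  let ?A = "sum qA F" and ?B = "sum qB F" and ?C = "sum qC F"
  have total: "(\<Sum>g\<in>F. qA g * x + qB g * y + qC g * w) = ?A * x + ?B * y + ?C * w" for x y w
    by (simp add: sum.distrib sum_distrib_right)
  have ne: "F \<noteq> {}" using F.one_closed by blast
  have pos: "(\<Sum>g\<in>F. qA g * x\<^sup>2 + 2 * qB g * x * y + qC g * y\<^sup>2) > 0" if "x \<noteq> 0 \<or> y \<noteq> 0" for x y
  proof (rule sum_pos[OF F(2) ne])
    fix g assume "g \<in> F"
    moreover obtain a b c d where g: "g = (a, b, c, d)" by (cases g)
    ultimately have det: "a * d - b * c = 1" using F.subset by auto
    have "a * x + b * y \<noteq> 0 \<or> c * x + d * y \<noteq> 0"
    proof (rule ccontr)
      assume "\<not> ?thesis"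
      then have "a * x + b * y = 0" "c * x + d * y = 0" by auto
      moreover have "(a * d - b * c) * x = d * (a * x + b * y) - b * (c * x + d * y)"
        "(a * d - b * c) * y = a * (c * x + d * y) - c * (a * x + b * y)"
        by (simp_all add: algebra_simps)
      ultimately have "x = 0" "y = 0" by (simp_all only: det mult_zero_right mult_1 diff_self)
      with that show False by simp
    qed
    then have "(a * x + b * y)\<^sup>2 + (c * x + d * y)\<^sup>2 > 0"
      by (simp add: sum_power2_gt_zero_iff)
    then show "qA g * x\<^sup>2 + 2 * qB g * x * y + qC g * y\<^sup>2 > 0"
      by (simp add: g qA_def qB_def qC_def power2_eq_square algebra_simps)
  qed
  have form_pos: "?A * x\<^sup>2 + 2 * ?B * x * y + ?C * y\<^sup>2 > 0" if "x \<noteq> 0 \<or> y \<noteq> 0" for x y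
    using pos[OF that] by (simp add: sum.distrib sum_distrib_left sum_distrib_right)
  have A: "?A > 0" using form_pos[of 1 0] by simp
  \<comment> \<open>At \<open>(-B, A)\<close> the form takes the value \<open>A (A C - B\<^sup>2)\<close>.\<close>
  have "?A * (?A * ?C - ?B\<^sup>2) > 0"
    using form_pos[of "- ?B" ?A] A by (simp add: power2_eq_square algebra_simps)
  then have D: "?A * ?C - ?B\<^sup>2 > 0"
    using A by (simp add: zero_less_mult_iff)
  have "?A * a\<^sup>2 + 2 * ?B * a * c + ?C * c\<^sup>2 = ?A \<and>
      ?A * a * b + ?B * (a * d + b * c) + ?C * c * d = ?B" if h: "(a, b, c, d) \<in> F" for a b c d
  proof -
    let ?h = "(a, b, c, d)"
    have bij: "bij_betw (\<lambda>g. g \<otimes>\<^bsub>SL2 K\<^esub> ?h) F F"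
    proof (rule bij_betw_byWitness[where f' = "\<lambda>g. g \<otimes>\<^bsub>SL2 K\<^esub> inv\<^bsub>SL2 K\<^esub> ?h"])
      show "\<forall>g\<in>F. g \<otimes>\<^bsub>SL2 K\<^esub> ?h \<otimes>\<^bsub>SL2 K\<^esub> inv\<^bsub>SL2 K\<^esub> ?h = g"
        "\<forall>g\<in>F. g \<otimes>\<^bsub>SL2 K\<^esub> inv\<^bsub>SL2 K\<^esub> ?h \<otimes>\<^bsub>SL2 K\<^esub> ?h = g"
        using h F.mem_carrier by (simp_all add: SL2.m_assoc del: SL2_mult SL2_one SL2_carrier)
      show "(\<lambda>g. g \<otimes>\<^bsub>SL2 K\<^esub> ?h) ` F \<subseteq> F" "(\<lambda>g. g \<otimes>\<^bsub>SL2 K\<^esub> inv\<^bsub>SL2 K\<^esub> ?h) ` F \<subseteq> F"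
        using h by (auto simp del: SL2_mult)
    qed
    have shift: "sum q F = (\<Sum>g\<in>F. q (g \<otimes>\<^bsub>SL2 K\<^esub> ?h))" for q :: "_ \<Rightarrow> real"
      using sum.reindex_bij_betw[OF bij, of q] by simp
    have "?A = (\<Sum>g\<in>F. qA g * a\<^sup>2 + qB g * (2 * a * c) + qC g * c\<^sup>2)"
      unfolding shift[of qA]
      by (intro sum.cong refl) (auto simp: qA_def qB_def qC_def power2_eq_square algebra_simps)
    moreover have "?B = (\<Sum>g\<in>F. qA g * (a * b) + qB g * (a * d + b * c) + qC g * (c * d))"
      unfolding shift[of qB]
      by (intro sum.cong refl) (auto simp: qA_def qB_def qC_def power2_eq_square algebra_simps)
    ultimately show ?thesis
      unfolding total by (simp add: mult_ac)
  qed
  with A D show thesis by (rule that)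
qed

text \<open>
  With \<open>Q\<close> the matrix of the invariant form, invariance reads \<open>g\<^sup>T Q = Q g\<^sup>-\<^sup>1\<close>, which is linear in the
  entries of \<open>g\<close> since \<open>det g = 1\<close>. These linear equations say that \<open>(z, 1)\<close> is an eigenvector
  of \<open>g\<close>, for the root \<open>z\<close> of the form in the upper half plane; they also determine \<open>a\<close> and
  \<open>b\<close> from \<open>c\<close> and \<open>d\<close>, and as \<open>z\<close> is not real, the eigenvalue \<open>c z + d\<close> determines \<open>c\<close> and
  \<open>d\<close>.
\<close>

lemma finite_subgroup_SL2_real_cyclic:
  fixes K :: "real set"
  assumes K: "subfield_char_0 K" and F: "subgroup F (SL2 K)" "finite F"
  shows "cyclic_group (SL2 K\<lparr>carrier := F\<rparr>)"
proof -
  interpret subfield_char_0 K by fact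
  interpret F: subgroup F "SL2 K" by fact
  obtain A B C where A: "A > 0" and D: "A * C - B\<^sup>2 > 0"
    and inv: "\<And>a b c d. (a, b, c, d) \<in> F \<Longrightarrow>
      A * a\<^sup>2 + 2 * B * a * c + C * c\<^sup>2 = A \<and> A * a * b + B * (a * d + b * c) + C * c * d = B"
    using invariant_quadratic_form[OF K F] by metis
  have lin: "A * b = - (C * c) \<and> A * (d - a) = 2 * B * c" if h: "(a, b, c, d) \<in> F" for a b c d
  proof -
    have det: "a * d - b * c = 1" using F.subset h by auto
    have form: "A * a\<^sup>2 + 2 * B * a * c + C * c\<^sup>2 = A"
      "A * a * b + B * (a * d + b * c) + C * c * d = B"
      using inv[OF h] by auto
    \<comment> \<open>Multiplying the equations for \<open>g\<^sup>T Q g = Q\<close> by \<open>g\<^sup>-\<^sup>1\<close> from the right makes them linear.\<close>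
    have "a * (A * a * b + B * (a * d + b * c) + C * c * d)
        - b * (A * a\<^sup>2 + 2 * B * a * c + C * c\<^sup>2) = (a * d - b * c) * (B * a + C * c)"
      "d * (A * a\<^sup>2 + 2 * B * a * c + C * c\<^sup>2)
        - c * (A * a * b + B * (a * d + b * c) + C * c * d) = (a * d - b * c) * (A * a + B * c)"
      by (simp_all add: power2_eq_square algebra_simps)
    then show ?thesis
      unfolding form det by (simp add: algebra_simps)
  qed
  define z where "z = Complex (- B / A) (sqrt (A * C - B\<^sup>2) / A)"
  have root: "A * z\<^sup>2 + 2 * B * z + C = 0"
    using A D by (simp add: z_def complex_eq_iff power2_eq_square field_simps)
  have im: "Im z > 0"
    using A D by (simp add: z_def)
  define \<chi> :: "real \<times> real \<times> real \<times> real \<Rightarrow> complex"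
    where "\<chi> = (\<lambda>(a, b, c, d). c * z + d)"
  have group: "group (SL2 K\<lparr>carrier := F\<rparr>)"
    by (rule F.subgroup_is_group[OF group_SL2])
  show ?thesis
  proof (rule group.cyclic_if_faithful_complex_character[OF group, of \<chi>])
    fix g h assume "g \<in> carrier (SL2 K\<lparr>carrier := F\<rparr>)" "h \<in> carrier (SL2 K\<lparr>carrier := F\<rparr>)"
    moreover obtain a b c d where h: "h = (a, b, c, d)" by (cases h)
    moreover obtain a' b' c' d' where g: "g = (a', b', c', d')" by (cases g)
    ultimately have hF: "(a, b, c, d) \<in> F" by simp
    have "complex_of_real (A * b + C * c) = 0" "complex_of_real (A * (d - a) - 2 * B * c) = 0"
      using lin[OF hF] by simp_all
    moreover have "A * (a * z + b) - A * (z * (c * z + d))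
        = complex_of_real (A * b + C * c) - complex_of_real (A * (d - a) - 2 * B * c) * z
          - c * (A * z\<^sup>2 + 2 * B * z + C)"
      by (simp add: power2_eq_square algebra_simps)
    ultimately have "A * (a * z + b) = A * (z * (c * z + d))"
      using root by simp
    then have key: "a * z + b = z * (c * z + d)" using A by simp
    have "\<chi> (g \<otimes>\<^bsub>SL2 K\<lparr>carrier := F\<rparr>\<^esub> h) = c' * (a * z + b) + d' * (c * z + d)"
      by (simp add: g h \<chi>_def algebra_simps)
    also have "\<dots> = \<chi> g * \<chi> h"
      unfolding key by (simp add: g h \<chi>_def algebra_simps)
    finally show "\<chi> (g \<otimes>\<^bsub>SL2 K\<lparr>carrier := F\<rparr>\<^esub> h) = \<chi> g * \<chi> h" .
  next
    show "inj_on \<chi> (carrier (SL2 K\<lparr>carrier := F\<rparr>))"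
    proof (rule inj_onI)
      fix g h assume gh: "g \<in> carrier (SL2 K\<lparr>carrier := F\<rparr>)" "h \<in> carrier (SL2 K\<lparr>carrier := F\<rparr>)"
        and eq: "\<chi> g = \<chi> h"
      obtain a b c d where h: "h = (a, b, c, d)" by (cases h)
      obtain a' b' c' d' where g: "g = (a', b', c', d')" by (cases g)
      have "c' = c" "d' = d"
        using eq im by (auto simp: g h \<chi>_def complex_eq_iff)
      moreover have "A * b' = A * b" "A * a' = A * a"
        using lin[of a b c d] lin[of a' b' c' d'] gh calculation
        by (simp_all add: g h algebra_simps)
      ultimately show "g = h" using A by (simp add: g h)
    qed
  qed (use F(2) in \<open>simp_all add: \<chi>_def\<close>)
qed

section \<open>A countable field with many rotations\<close>

text \<open>
  The subfield generated by a countable set is countable, because the arithmetical expressions over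
  that set form a countable type and evaluate onto the subfield.
\<close>

datatype trig_expr = Cos nat | Sin nat | One | Diff trig_expr trig_expr
  | Times trig_expr trig_expr | Inverse trig_expr

instance trig_expr :: countable
  by countable_datatype

primrec trig_eval :: "trig_expr \<Rightarrow> real" where
  "trig_eval (Cos n) = cos (pi / n)"
| "trig_eval (Sin n) = sin (pi / n)"
| "trig_eval One = 1"
| "trig_eval (Diff s t) = trig_eval s - trig_eval t"
| "trig_eval (Times s t) = trig_eval s * trig_eval t"
| "trig_eval (Inverse t) = inverse (trig_eval t)"

definition trig_field :: "real set" where
  "trig_field = range trig_eval"

lemma countable_trig_field: "countable trig_field"
  by (simp add: trig_field_def)

lemma cos_mem_trig_field: "cos (pi / n) \<in> trig_field" for n :: nat
  by (metis trig_field_def rangeI trig_eval.simps(1))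

lemma sin_mem_trig_field: "sin (pi / n) \<in> trig_field" for n :: nat
  by (metis trig_field_def rangeI trig_eval.simps(2))

interpretation trig_field: subfield_char_0 trig_field
proof
  show "1 \<in> trig_field"
    by (metis trig_field_def rangeI trig_eval.simps(3))
next
  fix x y assume "x \<in> trig_field" "y \<in> trig_field"
  then obtain s t where st: "x = trig_eval s" "y = trig_eval t"
    by (auto simp: trig_field_def)
  show "x - y \<in> trig_field"
    unfolding st trig_field_def by (metis rangeI trig_eval.simps(4))
  show "x * y \<in> trig_field"
    unfolding st trig_field_def by (metis rangeI trig_eval.simps(5))
  show "inverse x \<in> trig_field"
    unfolding st trig_field_def by (metis rangeI trig_eval.simps(6))
qed

lemma rotation_power:
  "(cos t, - sin t, sin t, cos t) [^]\<^bsub>SL2 K\<^esub> (n::nat) =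
    (cos (n * t), - sin (n * t), sin (n * t), cos (n * t :: real))"
  by (induction n) (simp_all add: cos_add sin_add algebra_simps)

theorem theorem3p1:
  shows "\<exists>M :: nat monoid.
    countable (carrier M) \<and>
    \<not> comm_group M \<and>
    is_simple M \<and>
    (\<forall>H. subgroup H M \<and> finite H \<longrightarrow> cyclic_group (M\<lparr>carrier := H\<rparr>)) \<and>
    (\<forall>p::nat. Factorial_Ring.prime p \<longrightarrow> (\<exists>x\<in>carrier M. group.ord M x = p))"
proof -
  let ?S = "SL2 trig_field" and ?Z = "plus_minus_one"
  have "countable (carrier ?S)"
    by (rule countable_subset[of _ "trig_field \<times> trig_field \<times> trig_field \<times> trig_field"])
      (auto simp: countable_trig_field)
  then obtain f :: "real \<times> real \<times> real \<times> real \<Rightarrow> nat" where f: "weak_group_morphism f ?Z ?S"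
    using trig_field.SL2.ex_image_group_nat[OF _ trig_field.centre_normal] by blast
  define M where "M = image_group f ?S"
  interpret f: group_hom ?S M f
    unfolding M_def by (rule trig_field.SL2.weak_group_morphism_group_hom[OF f])
  have surj: "f ` carrier ?S = carrier M"
    by (simp add: M_def image_group_carrier)
  have ker: "kernel ?S M f = ?Z"
    unfolding M_def by (rule trig_field.SL2.weak_group_morphism_ker[OF f])
  have eq_one: "f g = \<one>\<^bsub>M\<^esub> \<longleftrightarrow> g \<in> ?Z" if "g \<in> carrier ?S" for g
    using that ker by (auto simp: kernel_def)
  have "\<not> comm_group M"
  proof
    assume "comm_group M"
    then interpret M: comm_group M .
    let ?u = "(1, 1, 0, 1)" and ?l = "(1, 0, 1, 1)"
    have "f (?u \<otimes>\<^bsub>?S\<^esub> ?l) = f (?l \<otimes>\<^bsub>?S\<^esub> ?u)"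
      using M.m_comm[of "f ?u" "f ?l"] by (simp del: SL2_mult)
    then show False
      using weak_group_morphism.inj_mod_subgroup[OF f, of "(2, 1, 1, 1)" "(1, 1, 1, 2)"]
      by (simp add: trig_field.SL2_inv)
  qed
  moreover have "is_simple M"
  proof (rule f.is_simple_image[OF surj])
    have "(1, 1, 0, 1) \<in> carrier ?S - kernel ?S M f" by (simp add: ker)
    then show "kernel ?S M f \<noteq> carrier ?S" by blast
  qed (unfold ker, rule trig_field.normal_subgroup_SL2)
  moreover have "cyclic_group (M\<lparr>carrier := H\<rparr>)" if "subgroup H M" "finite H" for H
    using f.finite_subgroup_image_cyclic[OF surj _ finite_subgroup_SL2_real_cyclic that]
      trig_field.subfield_char_0_axioms by (simp add: ker)
  moreover
  \<comment> \<open>The angle is \<open>\<pi>/p\<close> and not \<open>2\<pi>/p\<close>, because \<open>-1\<close> is trivial in the quotient: for \<open>p = 2\<close> the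
    rotation by \<open>2\<pi>/p\<close> would be trivial.\<close>
  have "\<exists>x\<in>carrier M. group.ord M x = p" if p: "Factorial_Ring.prime p" for p :: nat
  proof
    let ?t = "pi / p"
    let ?r = "(cos ?t, - sin ?t, sin ?t, cos ?t)"
    have p2: "p \<ge> 2" using p by (rule prime_ge_2_nat)
    have r: "?r \<in> carrier ?S"
      using sin_cos_squared_add[of ?t]
      by (simp add: cos_mem_trig_field sin_mem_trig_field power2_eq_square add.commute)
    then show "f ?r \<in> carrier M" by simp
    have "f ?r [^]\<^bsub>M\<^esub> p = f (?r [^]\<^bsub>?S\<^esub> p)"
      by (rule f.hom_nat_pow[OF r, symmetric])
    also have "?r [^]\<^bsub>?S\<^esub> p = (-1, 0, 0, -1)"
      using p2 by (simp add: rotation_power)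
    also have "f (-1, 0, 0, -1) = \<one>\<^bsub>M\<^esub>"
      by (subst eq_one) simp_all
    finally have "f.H.ord (f ?r) dvd p"
      using f.H.pow_eq_id r by simp
    moreover have "f.H.ord (f ?r) \<noteq> 1"
    proof -
      have "sin ?t > 0"
        using p2 by (intro sin_gt_zero) (simp_all add: field_simps)
      then have "f ?r \<noteq> \<one>\<^bsub>M\<^esub>"
        using eq_one[OF r] by auto
      then show ?thesis
        using f.H.ord_eq_1 r by simp
    qed
    ultimately show "f.H.ord (f ?r) = p"
      using p by (auto simp: prime_nat_iff)
  qed
  ultimately show ?thesis
    by (intro exI[of _ M]) simp
qed

end
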